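(* Let $D$ be a domain in $\mathbb{C}$ and let $\lambda_1,\lambda_2\ge1$ be integers. For every $f\in\mathcal{O}(D\times D)$ and every $(z,t)\in U_D$, $$(T_{\lambda_1,\lambda_2}f)(z,t)=\sum_{\ell=0}^{\infty}\frac{(\lambda_1+\lambda_2+\ell-2)!\;t^{\ell}}{(\lambda_1+\ell-1)!\,(\lambda_2+\ell-1)!}\,(\mathrm{RC}_{\lambda_1,\lambda_2}^{(\ell)}f)(z).$$
   Context: $\mathcal{O}(\cdot)$ denotes the space of holomorphic functions. For a domain $D\subset\mathbb{C}$, $U_D:=\{(z,t)\in D\times\mathbb{C}:2|t|<d(z,\partial D)\}$, where $d(z,\partial D)$ is the distance from $z$ to the boundary $\partial D$, with $d(z,\partial D):=\infty$ if $D=\mathbb{C}$. Rankin--Cohen bracket: for integers $\lambda_1,\lambda_2\ge1$ and $\ell\ge0$, $\mathrm{RC}_{\lambda_1,\lambda_2}^{(\ell)}:\mathcal{O}(D\times D)\to\mathcal{O}(D)$ is $$(\mathrm{RC}_{\lambda_1,\lambda_2}^{(\ell)}f)(z)=\sum_{j=0}^{\ell}(-1)^j\binom{\lambda_1+\ell-1}{j}\binom{\lambda_2+\ell-1}{\ell-j}\left(\frac{\partial^{\ell}f}{\partial\zeta_1^{\ell-j}\,\partial\zeta_2^{j}}\right)(z,z).$$ Kernel and integral operator: put $$A_{\lambda_1,\lambda_2}(\zeta_1,\zeta_2;z,t):=\frac{(\zeta_1-\zeta_2)^{\lambda_1+\lambda_2-2}(\zeta_1-z)^{1-\lambda_2}(z-\zeta_2)^{1-\lambda_1}}{(\zeta_1-z)(\zeta_2-z)+t(\zeta_1-\zeta_2)},$$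 and for $f\in\mathcal{O}(D\times D)$ and $(z,t)\in U_D$ define $$(T_{\lambda_1,\lambda_2}f)(z,t):=\frac{1}{(2\pi\sqrt{-1})^2}\oint_{C_1}\oint_{C_2}A_{\lambda_1,\lambda_2}(\zeta_1,\zeta_2;z,t)f(\zeta_1,\zeta_2)\,d\zeta_1\,d\zeta_2,$$ where $\zeta_j$ runs over $C_j$ and $C_1=C_2$ is the positively oriented circle of radius $r$ centered at $z$, for any $r$ with $2|t|<r<d(z,\partial D)$, $r>0$ (on which $|t(\zeta_1-\zeta_2)|<|\zeta_1-z||\zeta_2-z|$, so the kernel is holomorphic there); the value does not depend on $r$. *)

theory Defs
  imports "HOL-Complex_Analysis.Complex_Analysis"
begin

text \<open>Holomorphy in two variables: Frechet differentiability with a complex-linear derivative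
  (the product type \<^typ>\<open>complex \<times> complex\<close> only carries a real vector space structure, so complex
  linearity is spelled out).\<close>

definition holomorphic2_on :: "(complex \<times> complex \<Rightarrow> complex) \<Rightarrow> (complex \<times> complex) set \<Rightarrow> bool"
  (infixl "holomorphic2'_on" 50) where
  "f holomorphic2_on S \<longleftrightarrow>
     (\<forall>p\<in>S. \<exists>a b. (f has_derivative (\<lambda>(h, k). a * h + b * k)) (at p within S))"

text \<open>The case distinction is needed since \<^term>\<open>infdist z {} = 0\<close>. A nonempty
  \<open>D \<noteq> UNIV\<close> has nonempty frontier.\<close>

definition bdist :: "complex set \<Rightarrow> complex \<Rightarrow> ereal" where
  "bdist D z = (if D = UNIV then \<infinity> else ereal (infdist z (frontier D)))"

definition U_dom :: "complex set \<Rightarrow> (complex \<times> complex) set" where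
  "U_dom D = {(z, t). z \<in> D \<and> ereal (2 * cmod t) < bdist D z}"

text \<open>\<open>mixed_deriv m n f z w\<close> is \<open>\<partial>\<^sup>m\<^sup>+\<^sup>n f / \<partial>\<zeta>\<^sub>1\<^sup>m \<partial>\<zeta>\<^sub>2\<^sup>n\<close> at \<open>(z, w)\<close>.\<close>

definition mixed_deriv ::
  "nat \<Rightarrow> nat \<Rightarrow> (complex \<times> complex \<Rightarrow> complex) \<Rightarrow> complex \<Rightarrow> complex \<Rightarrow> complex" where
  "mixed_deriv m n f z w =
     (deriv ^^ m) (\<lambda>\<zeta>1. (deriv ^^ n) (\<lambda>\<zeta>2. f (\<zeta>1, \<zeta>2)) w) z"

definition RC ::
  "nat \<Rightarrow> nat \<Rightarrow> nat \<Rightarrow> (complex \<times> complex \<Rightarrow> complex) \<Rightarrow> complex \<Rightarrow> complex" where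
  "RC l1 l2 l f z =
     (\<Sum>j=0..l. (-1) ^ j * of_nat ((l1 + l - 1) choose j) * of_nat ((l2 + l - 1) choose (l - j))
        * mixed_deriv (l - j) j f z z)"

definition A_kernel ::
  "nat \<Rightarrow> nat \<Rightarrow> complex \<Rightarrow> complex \<Rightarrow> complex \<Rightarrow> complex \<Rightarrow> complex" where
  "A_kernel l1 l2 \<zeta>1 \<zeta>2 z t =
     ((\<zeta>1 - \<zeta>2) ^ (l1 + l2 - 2) * (\<zeta>1 - z) powi (1 - int l2) * (z - \<zeta>2) powi (1 - int l1))
     / ((\<zeta>1 - z) * (\<zeta>2 - z) + t * (\<zeta>1 - \<zeta>2))"

text \<open>The radius \<open>r\<close> of the contour is an explicit parameter; the value is the same for every
  \<open>r\<close> with \<open>admissible_radius D z t r\<close>.\<close>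

definition admissible_radius :: "complex set \<Rightarrow> complex \<Rightarrow> complex \<Rightarrow> real \<Rightarrow> bool" where
  "admissible_radius D z t r \<longleftrightarrow> 0 < r \<and> 2 * cmod t < r \<and> ereal r < bdist D z"

definition T_op ::
  "nat \<Rightarrow> nat \<Rightarrow> real \<Rightarrow> (complex \<times> complex \<Rightarrow> complex) \<Rightarrow> complex \<Rightarrow> complex \<Rightarrow> complex" where
  "T_op l1 l2 r f z t =
     1 / (2 * of_real pi * \<i>) ^ 2 *
     contour_integral (circlepath z r) (\<lambda>\<zeta>1.
       contour_integral (circlepath z r) (\<lambda>\<zeta>2.
         A_kernel l1 l2 \<zeta>1 \<zeta>2 z t * f (\<zeta>1, \<zeta>2)))"

end

theory Submission
  imports Defs
begin

text \<open>
  Put \<open>a = \<zeta>\<^sub>1 - z\<close> and \<open>b = \<zeta>\<^sub>2 - z\<close>. On the circles \<open>\<bar>a\<bar> = \<bar>b\<bar> = r\<close> with \<open>r > 2\<bar>t\<bar>\<close> one has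
  \<open>\<bar>t (a - b)\<bar> \<le> 2 \<bar>t\<bar> r < \<bar>a b\<bar>\<close>, so \<open>1 / (a b + t (a - b))\<close> is a geometric series in \<open>t\<close> that converges
  uniformly and may be integrated term by term in both variables
  (\<open>A_kernel_sums\<close>, \<open>norm_kernel_term_le\<close>, \<open>circlepath_integral_sums\<close>).

  The binomial theorem turns the coefficient of \<open>t\<^sup>l\<close> in the kernel into a combination of monomials
  \<open>a\<^sup>p b\<^sup>q\<close> with \<open>p + q = - l - 2\<close> (\<open>kernel_term_monomials\<close>). Against \<open>f\<close>, such a monomial integrates by
  Cauchy's formula to \<open>(2\<pi>\<i>)\<^sup>2\<close> times a Taylor coefficient of \<open>f\<close> of order \<open>(- p - 1, - q - 1)\<close> at \<open>(z, z)\<close>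
  if \<open>p\<close> and \<open>q\<close> are both negative, and to \<open>0\<close> otherwise (\<open>double_circlepath_moment\<close>). Exactly the
  \<open>l + 1\<close> partial derivatives of total order \<open>l\<close> survive, and \<open>binomial_fact_Rankin_Cohen\<close> matches their
  coefficients with those of the Rankin--Cohen bracket.

  Cauchy's formula in the outer variable needs \<open>\<partial>\<^sub>2\<^sup>n f(\<zeta>, z)\<close> to be holomorphic in \<open>\<zeta>\<close>. This is
  \<open>higher_deriv_snd_holomorphic\<close>, where this derivative is written as a circle integral that depends
  holomorphically on a parameter. The whole argument takes place on the closed bidisc of radius
  \<open>r\<close> around \<open>(z, z)\<close>, which lies in \<open>D \<times> D\<close> because \<open>r\<close> is below the distance to the boundary.
\<close>

section \<open>Integrals over circles\<close>

lemma continuous_on_slices: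
  assumes "continuous_on (A \<times> B) (\<lambda>(x, y). F x y)"
  shows "y \<in> B \<Longrightarrow> continuous_on A (\<lambda>x. F x y)"
    and "x \<in> A \<Longrightarrow> continuous_on B (F x)"
proof -
  show "continuous_on A (\<lambda>x. F x y)" if "y \<in> B"
    using continuous_on_compose2[OF assms, of A "\<lambda>x. (x, y)"] that by (force intro: continuous_intros)
  show "continuous_on B (F x)" if "x \<in> A"
    using continuous_on_compose2[OF assms, of B "\<lambda>y. (x, y)"] that by (force intro: continuous_intros)
qed

lemma circlepath_integral_sums:
  assumes "0 < r" and "summable M"
    and int: "\<And>n. F n contour_integrable_on circlepath z r"
    and bound: "\<And>n u. u \<in> sphere z r \<Longrightarrow> norm (F n u) \<le> M n"
    and sums: "\<And>u. u \<in> sphere z r \<Longrightarrow> (\<lambda>n. F n u) sums G u"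
  shows "(\<lambda>n. contour_integral (circlepath z r) (F n)) sums contour_integral (circlepath z r) G"
proof -
  have "uniform_limit (sphere z r) (\<lambda>N u. \<Sum>n<N. F n u) (\<lambda>u. \<Sum>n. F n u) sequentially"
    using bound \<open>summable M\<close> by (rule Weierstrass_m_test)
  then have ul: "uniform_limit (sphere z r) (\<lambda>N u. \<Sum>n<N. F n u) G sequentially"
    by (rule uniform_limit_cong'[THEN iffD1, rotated -1]) (use sums sums_unique in \<open>fastforce+\<close>)
  have "(\<lambda>N. contour_integral (circlepath z r) (\<lambda>u. \<Sum>n<N. F n u))
          \<longlonglongrightarrow> contour_integral (circlepath z r) G"
    by (rule contour_integral_uniform_limit_circlepath[OF _ ul])
       (use \<open>0 < r\<close> int in \<open>auto intro!: always_eventually contour_integrable_sum\<close>)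
  then show ?thesis
    by (simp add: sums_def contour_integral_sum int)
qed

lemma continuous_on_circlepath_integral_param:
  assumes "0 \<le> s" and contF: "continuous_on (S \<times> sphere w s) (\<lambda>(x, y). F x y)"
  shows "continuous_on S (\<lambda>x. contour_integral (circlepath w s) (F x))"
proof -
  have "continuous_on (S \<times> {0..1}) (\<lambda>p. (\<lambda>(x, y). F x y) (fst p, circlepath w s (snd p)))"
  proof (rule continuous_on_compose2[OF contF])
    have "continuous_on {0..1} (circlepath w s)"
      using path_circlepath unfolding path_def .
    then have "continuous_on (S \<times> {0..1::real}) (\<lambda>p. circlepath w s (snd p))"
      by (rule continuous_on_compose2) (auto intro!: continuous_intros)
    then show "continuous_on (S \<times> {0..1::real}) (\<lambda>p. (fst p, circlepath w s (snd p)))"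
      by (intro continuous_intros)
    have "circlepath w s x \<in> sphere w s" if "x \<in> {0..1}" for x
      using that path_image_circlepath[of w s] \<open>0 \<le> s\<close> unfolding path_image_def by auto
    then show "(\<lambda>p. (fst p, circlepath w s (snd p))) ` (S \<times> {0..1}) \<subseteq> S \<times> sphere w s"
      by auto
  qed
  then have "continuous_on (S \<times> cbox 0 1)
     (\<lambda>(x, u). F x (circlepath w s u) * (2 * pi * \<i> * s * exp (2 * of_real pi * \<i> * u)))"
    unfolding case_prod_unfold by (intro continuous_intros) auto
  then have "continuous_on S (\<lambda>x. integral (cbox 0 1)
     (\<lambda>u. F x (circlepath w s u) * (2 * pi * \<i> * s * exp (2 * of_real pi * \<i> * u))))"
    by (rule integral_continuous_on_param)
  then show ?thesis
    by (simp add: contour_integral_integral vector_derivative_circlepath)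
qed

text \<open>Fubini shows that the parametrised integral again satisfies Cauchy's integral formula in the
  parameter; a continuous function that is its own Cauchy integral can be differentiated under that
  integral.\<close>

lemma holomorphic_on_circlepath_integral_param:
  assumes "0 \<le> s" and contF: "continuous_on (cball z r \<times> sphere w s) (\<lambda>(x, y). F x y)"
    and holF: "\<And>y. y \<in> sphere w s \<Longrightarrow> (\<lambda>x. F x y) holomorphic_on ball z r"
  shows "(\<lambda>x. contour_integral (circlepath w s) (F x)) holomorphic_on ball z r"
proof (cases "0 < r")
  case True
  define J where "J x = contour_integral (circlepath w s) (F x)" for x
  have contJ: "continuous_on (cball z r) J"
    unfolding J_def using assms(1,2) by (rule continuous_on_circlepath_integral_param)
  then have contJ': "continuous_on (path_image (circlepath z r)) J"
    by (rule continuous_on_subset) (use True in auto)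
  note contFx = continuous_on_slices(1)[OF contF] and contFy = continuous_on_slices(2)[OF contF]
  have repr: "((\<lambda>u. J u / (u - x) ^ 1) has_contour_integral 2 * of_real pi * \<i> * J x) (circlepath z r)"
    if x: "x \<in> ball z r" for x
  proof -
    have ne: "u \<noteq> x" if "u \<in> sphere z r" for u
      using that x by auto
    have "contour_integral (circlepath z r) (\<lambda>u. J u / (u - x))
        = contour_integral (circlepath z r) (\<lambda>u. contour_integral (circlepath w s) (\<lambda>y. F u y / (u - x)))"
    proof (rule contour_integral_cong[OF refl])
      fix u assume "u \<in> path_image (circlepath z r)"
      then have "u \<in> cball z r" using True by auto
      then have "F u contour_integrable_on circlepath w s"
        using contFy \<open>0 \<le> s\<close> by (intro contour_integrable_continuous_circlepath) auto
      then show "J u / (u - x) = contour_integral (circlepath w s) (\<lambda>y. F u y / (u - x))"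
        unfolding J_def by (simp add: contour_integral_div)
    qed
    also have "\<dots> = contour_integral (circlepath w s) (\<lambda>y. contour_integral (circlepath z r) (\<lambda>u. F u y / (u - x)))"
    proof (rule contour_integral_swap)
      have "continuous_on (sphere z r \<times> sphere w s) (\<lambda>(x, y). F x y)"
        using contF by (rule continuous_on_subset) auto
      then have "continuous_on (sphere z r \<times> sphere w s) (\<lambda>(u, y). F u y / (u - x))"
        unfolding case_prod_unfold using ne by (intro continuous_intros) auto
      then show "continuous_on (path_image (circlepath z r) \<times> path_image (circlepath w s))
          (\<lambda>(u, y). F u y / (u - x))"
        using True \<open>0 \<le> s\<close> by simp
    qed (auto simp: vector_derivative_circlepath intro!: continuous_intros)
    also have "\<dots> = contour_integral (circlepath w s) (\<lambda>y. 2 * of_real pi * \<i> * F x y)"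
    proof (rule contour_integral_cong[OF refl])
      fix y assume "y \<in> path_image (circlepath w s)"
      then have "y \<in> sphere w s" using \<open>0 \<le> s\<close> by simp
      then show "contour_integral (circlepath z r) (\<lambda>u. F u y / (u - x)) = 2 * of_real pi * \<i> * F x y"
        using x by (intro contour_integral_unique Cauchy_integral_circlepath contFx holF)
          (auto simp: dist_norm norm_minus_commute)
    qed
    also have "\<dots> = 2 * of_real pi * \<i> * J x"
      unfolding J_def using contFy[of x] x \<open>0 \<le> s\<close>
      by (intro contour_integral_lmul contour_integrable_continuous_circlepath) auto
    finally have eq: "contour_integral (circlepath z r) (\<lambda>u. J u / (u - x)) = 2 * of_real pi * \<i> * J x" .
    have "(\<lambda>u. J u / (u - x)) contour_integrable_on circlepath z r"
      using contJ' ne True by (intro contour_integrable_continuous_circlepath continuous_intros) auto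
    then show ?thesis
      using has_contour_integral_integral eq by fastforce
  qed
  have "(\<lambda>x. 2 * of_real pi * \<i> * J x) holomorphic_on ball z r"
    using Cauchy_next_derivative_circlepath(2)[OF contJ' repr]
    unfolding holomorphic_on_open[OF open_ball] by blast
  then have "(\<lambda>x. 2 * of_real pi * \<i> * J x / (2 * of_real pi * \<i>)) holomorphic_on ball z r"
    by (intro holomorphic_on_divide holomorphic_on_const) auto
  then show ?thesis
    by (simp add: J_def)
qed (simp add: ball_empty holomorphic_on_def)

text \<open>The two cases are Cauchy's formula for derivatives and Cauchy's theorem, for a function that is
  only continuous up to the circle. Treating all integer exponents at once lets the expanded
  kernel be integrated monomial by monomial.\<close>

lemma has_contour_integral_power_int_circlepath:
  assumes "0 < r" and conth: "continuous_on (cball z r) h" and holh: "h holomorphic_on ball z r"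
  shows "((\<lambda>u. (u - z) powi e * h u) has_contour_integral
           (if e < 0 then 2 * of_real pi * \<i> * (deriv ^^ nat (- e - 1)) h z / fact (nat (- e - 1)) else 0))
         (circlepath z r)"
proof (cases "e < 0")
  case True
  define k where "k = nat (- e - 1)"
  have e: "e = - int (Suc k)" using True by (simp add: k_def)
  have "((\<lambda>u. h u / (u - z) ^ Suc k) has_contour_integral
      2 * of_real pi * \<i> / fact k * (deriv ^^ k) h z) (circlepath z r)"
    using Cauchy_has_contour_integral_higher_derivative_circlepath[OF conth holh, of z k] \<open>0 < r\<close>
    by simp
  moreover have "h u / (u - z) ^ Suc k = (u - z) powi e * h u" for u
    unfolding e power_int_minus power_int_of_nat by (simp add: divide_inverse)
  ultimately show ?thesis
    using True by (simp add: k_def[symmetric] del: power_Suc)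
next
  case False
  then obtain k where e: "e = int k" by (metis nonneg_int_cases not_less)
  \<comment> \<open>Cauchy's formula at the zero of \<open>(u - z) ^ Suc k * h u\<close>.\<close>
  have "((\<lambda>u. (u - z) ^ Suc k * h u / (u - z)) has_contour_integral
      2 * of_real pi * \<i> * ((z - z) ^ Suc k * h z)) (circlepath z r)"
    using assms by (intro Cauchy_integral_circlepath continuous_intros holomorphic_intros) auto
  then have "((\<lambda>u. (u - z) ^ Suc k * h u / (u - z)) has_contour_integral 0) (circlepath z r)"
    by simp
  then show ?thesis
    using False \<open>0 < r\<close> unfolding e
    by (auto elim!: has_contour_integral_eq)
qed

section \<open>Double moments\<close>

text \<open>By Cauchy's formula the derivative at the centre is an integral over the boundary circle of a
  kernel that does not involve \<open>x\<close>, times \<open>f (x, y)\<close>.\<close>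

lemma higher_deriv_snd_holomorphic:
  assumes "0 < s" and contf: "continuous_on (cball z r \<times> cball w s) f"
    and hol1: "\<And>y. y \<in> cball w s \<Longrightarrow> (\<lambda>x. f (x, y)) holomorphic_on ball z r"
    and hol2: "\<And>x. x \<in> cball z r \<Longrightarrow> (\<lambda>y. f (x, y)) holomorphic_on ball w s"
  shows "continuous_on (cball z r) (\<lambda>x. (deriv ^^ n) (\<lambda>y. f (x, y)) w)"
    and "(\<lambda>x. (deriv ^^ n) (\<lambda>y. f (x, y)) w) holomorphic_on ball z r"
proof -
  define P where "P x = (deriv ^^ n) (\<lambda>y. f (x, y)) w" for x
  define J where "J x = contour_integral (circlepath w s) (\<lambda>y. f (x, y) / (y - w) ^ Suc n)" for x
  have PJ: "P x = fact n / (2 * pi * \<i>) * J x" if "x \<in> cball z r" for x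
  proof -
    have "continuous_on (cball w s) (\<lambda>y. f (x, y))"
      using continuous_on_slices(2)[of _ _ "\<lambda>x y. f (x, y)"] contf that by simp
    then show ?thesis
      unfolding P_def J_def using hol2[OF that] \<open>0 < s\<close>
      by (intro Cauchy_higher_derivative_integral_circlepath(2)) auto
  qed
  have "continuous_on (cball z r \<times> sphere w s) f"
    using contf by (rule continuous_on_subset) auto
  then have contF: "continuous_on (cball z r \<times> sphere w s) (\<lambda>(x, y). f (x, y) / (y - w) ^ Suc n)"
    unfolding case_prod_unfold prod.collapse using \<open>0 < s\<close>
    by (intro continuous_intros) auto
  have "continuous_on (cball z r) J"
    unfolding J_def using \<open>0 < s\<close> contF by (intro continuous_on_circlepath_integral_param) auto
  then have "continuous_on (cball z r) (\<lambda>x. fact n / (2 * pi * \<i>) * J x)"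
    by (intro continuous_intros)
  then show "continuous_on (cball z r) P"
    by (subst continuous_on_cong[OF refl PJ]) auto
  have "J holomorphic_on ball z r"
    unfolding J_def
  proof (rule holomorphic_on_circlepath_integral_param[OF _ contF])
    show "(\<lambda>x. f (x, y) / (y - w) ^ Suc n) holomorphic_on ball z r" if "y \<in> sphere w s" for y
      using that \<open>0 < s\<close> by (intro holomorphic_intros hol1) auto
  qed (use \<open>0 < s\<close> in auto)
  then have "(\<lambda>x. fact n / (2 * pi * \<i>) * J x) holomorphic_on ball z r"
    by (intro holomorphic_intros)
  then show "P holomorphic_on ball z r"
    by (rule holomorphic_transform) (simp add: PJ)
qed

lemma double_circlepath_moment:
  assumes "0 < r" and contf: "continuous_on (cball z r \<times> cball z r) f"
    and hol1: "\<And>y. y \<in> cball z r \<Longrightarrow> (\<lambda>x. f (x, y)) holomorphic_on ball z r"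
    and hol2: "\<And>x. x \<in> cball z r \<Longrightarrow> (\<lambda>y. f (x, y)) holomorphic_on ball z r"
  shows "((\<lambda>x. contour_integral (circlepath z r) (\<lambda>y. (x - z) powi p * (y - z) powi q * f (x, y)))
      has_contour_integral
      (if p < 0 \<and> q < 0 then (2 * of_real pi * \<i>)\<^sup>2 *
           mixed_deriv (nat (- p - 1)) (nat (- q - 1)) f z z / (fact (nat (- p - 1)) * fact (nat (- q - 1)))
       else 0)) (circlepath z r)"
proof -
  define k where "k = nat (- q - 1)"
  define P where "P x = (deriv ^^ k) (\<lambda>y. f (x, y)) z" for x
  define c where "c = (if q < 0 then 2 * of_real pi * \<i> / fact k else 0)"
  have P: "continuous_on (cball z r) P" "P holomorphic_on ball z r"
    unfolding P_def using higher_deriv_snd_holomorphic[OF assms] by auto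
  have inner: "contour_integral (circlepath z r) (\<lambda>y. (x - z) powi p * (y - z) powi q * f (x, y))
      = c * ((x - z) powi p * P x)" if "x \<in> path_image (circlepath z r)" for x
  proof -
    have x: "x \<in> cball z r" using that \<open>0 < r\<close> by auto
    have "continuous_on (cball z r) (\<lambda>y. f (x, y))"
      using continuous_on_slices(2)[of _ _ "\<lambda>x y. f (x, y)"] contf x by simp
    from has_contour_integral_power_int_circlepath[OF \<open>0 < r\<close> this hol2[OF x], of q]
    have "((\<lambda>y. (y - z) powi q * f (x, y)) has_contour_integral c * P x) (circlepath z r)"
      by (simp add: c_def P_def k_def split: if_splits)
    from has_contour_integral_lmul[OF this, of "(x - z) powi p"] show ?thesis
      by (simp add: contour_integral_unique mult_ac)
  qed
  have "((\<lambda>x. c * ((x - z) powi p * P x)) has_contour_integral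
      c * (if p < 0 then 2 * of_real pi * \<i> * (deriv ^^ nat (- p - 1)) P z / fact (nat (- p - 1)) else 0))
      (circlepath z r)"
    by (intro has_contour_integral_lmul has_contour_integral_power_int_circlepath \<open>0 < r\<close> P)
  then have "((\<lambda>x. contour_integral (circlepath z r) (\<lambda>y. (x - z) powi p * (y - z) powi q * f (x, y)))
      has_contour_integral
      c * (if p < 0 then 2 * of_real pi * \<i> * (deriv ^^ nat (- p - 1)) P z / fact (nat (- p - 1)) else 0))
      (circlepath z r)"
    by (rule has_contour_integral_eq) (simp add: inner)
  then show ?thesis
    by (rule back_subst[of "\<lambda>v. (_ has_contour_integral v) _"])
       (auto simp: c_def P_def[abs_def] k_def mixed_deriv_def power2_eq_square mult_ac)
qed

section \<open>Expansion of the kernel\<close>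

text \<open>The \<open>l\<close>-th term of the geometric series of \<open>A_kernel (Suc m1) (Suc m2)\<close> in
  \<open>- t (a - b) / (a b)\<close>, where \<open>a = \<zeta>\<^sub>1 - z\<close> and \<open>b = \<zeta>\<^sub>2 - z\<close>. Writing the weights as successors makes
  all exponents natural numbers.\<close>

definition kernel_term :: "nat \<Rightarrow> nat \<Rightarrow> complex \<Rightarrow> nat \<Rightarrow> complex \<Rightarrow> complex \<Rightarrow> complex" where
  "kernel_term m1 m2 t l a b =
     (a - b) ^ (m1 + m2) / (a ^ Suc m2 * (- 1) ^ m1 * b ^ Suc m1) * (- (t * (a - b)) / (a * b)) ^ l"

lemma A_kernel_sums:
  assumes small: "norm (t * (x - y)) < norm ((x - z) * (y - z))"
  shows "(\<lambda>l. kernel_term m1 m2 t l (x - z) (y - z)) sums A_kernel (Suc m1) (Suc m2) x y z t"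
proof -
  define a b where "a = x - z" and "b = y - z"
  define \<rho> where "\<rho> = - (t * (a - b)) / (a * b)"
  define B where "B = (a - b) ^ (m1 + m2) / (a ^ Suc m2 * (- 1) ^ m1 * b ^ Suc m1)"
  have xy: "x - y = a - b" and zy: "z - y = - b" by (simp_all add: a_def b_def)
  have small': "norm (t * (a - b)) < norm (a * b)" using small unfolding xy a_def[symmetric] b_def[symmetric] .
  then have nz: "a \<noteq> 0" "b \<noteq> 0" by auto
  have "norm \<rho> < 1"
    unfolding \<rho>_def norm_divide norm_minus_cancel using small' nz by (subst divide_less_eq_1_pos) auto
  then have "(\<lambda>l. B * \<rho> ^ l) sums (B * (1 / (1 - \<rho>)))"
    by (intro sums_mult geometric_sums)
  moreover have "B * (1 / (1 - \<rho>)) = A_kernel (Suc m1) (Suc m2) x y z t"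
  proof -
    have 1: "1 - \<rho> = (a * b + t * (a - b)) / (a * b)"
      using nz by (simp add: \<rho>_def field_simps)
    have 2: "A_kernel (Suc m1) (Suc m2) x y z t
        = (a - b) ^ (m1 + m2) * inverse (a ^ m2) * inverse ((- b) ^ m1) / (a * b + t * (a - b))"
      unfolding A_kernel_def xy zy
      by (simp add: a_def[symmetric] b_def[symmetric] power_int_minus power_int_of_nat)
    have 3: "(- b) ^ m1 = (- 1) ^ m1 * b ^ m1" by (rule power_minus)
    define d where "d = a * b + t * (a - b)"
    have "d \<noteq> 0"
      using small' by (metis d_def add_eq_0_iff norm_minus_cancel less_irrefl)
    then show ?thesis
      unfolding 1 2 3 B_def d_def[symmetric] using nz by (simp add: field_simps)
  qed
  ultimately show ?thesis
    by (simp add: kernel_term_def B_def \<rho>_def a_def b_def)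
qed

text \<open>The factor \<open>(a - b) ^ (m1 + m2 + l)\<close> is expanded in powers of \<open>a\<close>. The exponents are integers
  because the outermost monomials may have a nonnegative exponent in one of the variables.\<close>

lemma kernel_term_monomials:
  assumes "a \<noteq> 0" "b \<noteq> 0"
  shows "kernel_term m1 m2 t l a b =
    (\<Sum>k\<le>m1 + m2 + l. t ^ l * ((- 1) ^ (m2 + k) * of_nat ((m1 + m2 + l) choose k)) *
       (a powi (int k - int m2 - int l - 1) * b powi (int m2 - 1 - int k)))"
proof -
  define N where "N = m1 + m2 + l"
  have "kernel_term m1 m2 t l a b
      = (- 1) ^ (m1 + l) * t ^ l * (a + (- b)) ^ N / (a ^ (m2 + l + 1) * b ^ (m1 + l + 1))"
  proof -
    have "(- (t * (a - b)) / (a * b)) ^ l = (- 1) ^ l * t ^ l * (a - b) ^ l / (a ^ l * b ^ l)"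
      by (metis (no_types, lifting) power_divide power_minus power_mult_distrib mult.assoc)
    moreover have "1 / (- 1) ^ m1 = ((- 1) ^ m1 :: complex)"
      by (simp add: power_one_over[symmetric] del: power_one_over)
    ultimately show ?thesis
      using assms by (simp add: kernel_term_def N_def power_add divide_simps)
  qed
  also have "\<dots> = (\<Sum>k\<le>N. (- 1) ^ (m1 + l) * t ^ l * (of_nat (N choose k) * a ^ k * (- b) ^ (N - k))
      / (a ^ (m2 + l + 1) * b ^ (m1 + l + 1)))"
    unfolding binomial_ring by (simp only: sum_distrib_left sum_divide_distrib)
  also have "\<dots> = (\<Sum>k\<le>N. t ^ l * ((- 1) ^ (m2 + k) * of_nat (N choose k)) *
       (a powi (int k - int m2 - int l - 1) * b powi (int m2 - 1 - int k)))"
  proof (rule sum.cong[OF refl])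
    fix k assume "k \<in> {..N}"
    then have kN: "k \<le> N" by simp
    have "even (m1 + l + (N - k)) \<longleftrightarrow> even (m2 + k)"
      using kN by (auto simp: N_def)
    then have s: "(- 1) ^ (m1 + l) * (- 1) ^ (N - k) = ((- 1) ^ (m2 + k) :: complex)"
      unfolding power_add[symmetric] by (simp add: minus_one_power_iff)
    have ea: "a powi (int k - int m2 - int l - 1) = a ^ k / a ^ (m2 + l + 1)"
    proof -
      have "int k - int m2 - int l - 1 = int k - int (m2 + l + 1)" by simp
      then show ?thesis using assms by (simp only: power_int_diff power_int_of_nat simp_thms)
    qed
    have eb: "b powi (int m2 - 1 - int k) = b ^ (N - k) / b ^ (m1 + l + 1)"
    proof -
      have "int m2 - 1 - int k = int (N - k) - int (m1 + l + 1)" using kN by (simp add: N_def)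
      then show ?thesis using assms by (simp only: power_int_diff power_int_of_nat simp_thms)
    qed
    have "(- 1) ^ (m1 + l) * t ^ l * (of_nat (N choose k) * a ^ k * (- b) ^ (N - k))
        / (a ^ (m2 + l + 1) * b ^ (m1 + l + 1))
      = t ^ l * (((- 1) ^ (m1 + l) * (- 1) ^ (N - k)) * of_nat (N choose k)) *
        (a ^ k / a ^ (m2 + l + 1) * (b ^ (N - k) / b ^ (m1 + l + 1)))"
      unfolding power_minus[of b] by simp
    then show "(- 1) ^ (m1 + l) * t ^ l * (of_nat (N choose k) * a ^ k * (- b) ^ (N - k))
        / (a ^ (m2 + l + 1) * b ^ (m1 + l + 1)) = t ^ l * ((- 1) ^ (m2 + k) * of_nat (N choose k)) *
       (a powi (int k - int m2 - int l - 1) * b powi (int m2 - 1 - int k))"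
      unfolding s ea eb .
  qed
  finally show ?thesis unfolding N_def .
qed

text \<open>Geometric decay in \<open>l\<close> since \<open>2 \<bar>t\<bar> < r\<close>; this is the majorant for termwise integration.\<close>

lemma norm_kernel_term_le:
  assumes "0 < r" "norm a = r" "norm b = r"
  shows "norm (kernel_term m1 m2 t l a b) \<le> (2 * r) ^ (m1 + m2) / r ^ (m1 + m2 + 2) * (2 * norm t / r) ^ l"
proof -
  have ab: "norm (a - b) \<le> 2 * r"
    using norm_triangle_ineq4[of a b] assms by simp
  have "norm (kernel_term m1 m2 t l a b)
      = norm (a - b) ^ (m1 + m2) / r ^ (m1 + m2 + 2) * (norm t * norm (a - b) / (r * r)) ^ l"
    using assms by (simp add: kernel_term_def norm_mult norm_divide norm_power power_add mult_ac)
  also have "\<dots> \<le> (2 * r) ^ (m1 + m2) / r ^ (m1 + m2 + 2) * (norm t * (2 * r) / (r * r)) ^ l"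
    using ab assms by (intro mult_mono power_mono divide_right_mono mult_left_mono) auto
  finally show ?thesis using assms by (simp add: mult_ac)
qed

lemma continuous_on_kernel_term:
  assumes "0 < r"
  shows "continuous_on (sphere z r \<times> sphere z r) (\<lambda>(x, y). kernel_term m1 m2 t l (x - z) (y - z))"
  unfolding case_prod_unfold kernel_term_def using assms
  by (intro continuous_intros) auto

section \<open>Termwise integration\<close>

text \<open>The left side is what the binomial theorem and the Taylor factorials produce for the derivative
  of order \<open>(l - j, j)\<close>; the right side is its coefficient in the Rankin--Cohen bracket, with the
  factor that is independent of \<open>j\<close> split off.\<close>

lemma binomial_fact_Rankin_Cohen:
  assumes "j \<le> l"
  shows "of_nat ((m1 + m2 + l) choose (m2 + j)) / (fact (l - j) * fact j)
     = (fact (m1 + m2 + l) / (fact (m1 + l) * fact (m2 + l)) *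
        (of_nat ((m1 + l) choose j) * of_nat ((m2 + l) choose (l - j))) :: complex)"
proof -
  have "m1 + m2 + l - (m2 + j) = m1 + l - j" "m2 + l - (l - j) = m2 + j" using assms by auto
  then show ?thesis
    using assms by (simp add: binomial_fact field_simps)
qed

lemma double_integral_kernel_term:
  assumes "0 < r" and contf: "continuous_on (cball z r \<times> cball z r) f"
    and hol1: "\<And>y. y \<in> cball z r \<Longrightarrow> (\<lambda>x. f (x, y)) holomorphic_on ball z r"
    and hol2: "\<And>x. x \<in> cball z r \<Longrightarrow> (\<lambda>y. f (x, y)) holomorphic_on ball z r"
  shows "contour_integral (circlepath z r) (\<lambda>x. contour_integral (circlepath z r)
           (\<lambda>y. kernel_term m1 m2 t l (x - z) (y - z) * f (x, y)))
       = (2 * of_real pi * \<i>)\<^sup>2 * (fact (m1 + m2 + l) * t ^ l / (fact (m1 + l) * fact (m2 + l))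
           * RC (Suc m1) (Suc m2) l f z)"
proof -
  let ?C = "circlepath z r"
  define N where "N = m1 + m2 + l"
  define c where "c k = t ^ l * ((- 1) ^ (m2 + k) * of_nat (N choose k))" for k
  define p q where "p k = int k - int m2 - int l - 1" and "q k = int m2 - 1 - int k" for k
  define I where "I k = (if p k < 0 \<and> q k < 0 then (2 * of_real pi * \<i>)\<^sup>2 *
           mixed_deriv (nat (- p k - 1)) (nat (- q k - 1)) f z z / (fact (nat (- p k - 1)) * fact (nat (- q k - 1)))
       else 0)" for k
  have inner: "contour_integral ?C (\<lambda>y. kernel_term m1 m2 t l (x - z) (y - z) * f (x, y))
      = (\<Sum>k\<le>N. c k * contour_integral ?C (\<lambda>y. (x - z) powi p k * (y - z) powi q k * f (x, y)))"
    if "x \<in> path_image ?C" for x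
  proof -
    have x: "x \<in> sphere z r" using that \<open>0 < r\<close> by simp
    have contx: "continuous_on (sphere z r) (\<lambda>y. f (x, y))"
    proof (rule continuous_on_subset)
      show "continuous_on (cball z r) (\<lambda>y. f (x, y))"
        using continuous_on_slices(2)[of _ _ "\<lambda>x y. f (x, y)"] contf x by auto
    qed auto
    have int: "(\<lambda>y. (x - z) powi p k * (y - z) powi q k * f (x, y)) contour_integrable_on ?C" for k
      using \<open>0 < r\<close> contx
      by (intro contour_integrable_continuous_circlepath continuous_intros) auto
    have "contour_integral ?C (\<lambda>y. kernel_term m1 m2 t l (x - z) (y - z) * f (x, y))
      = contour_integral ?C (\<lambda>y. \<Sum>k\<le>N. c k * ((x - z) powi p k * (y - z) powi q k * f (x, y)))"
    proof (rule contour_integral_cong[OF refl])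
      fix y assume "y \<in> path_image ?C"
      then have "x - z \<noteq> 0" "y - z \<noteq> 0" using x \<open>0 < r\<close> by auto
      then show "kernel_term m1 m2 t l (x - z) (y - z) * f (x, y)
          = (\<Sum>k\<le>N. c k * ((x - z) powi p k * (y - z) powi q k * f (x, y)))"
        unfolding kernel_term_monomials[OF \<open>x - z \<noteq> 0\<close> \<open>y - z \<noteq> 0\<close>] sum_distrib_right
        by (simp add: c_def p_def q_def N_def mult.assoc)
    qed
    also have "\<dots> = (\<Sum>k\<le>N. c k * contour_integral ?C (\<lambda>y. (x - z) powi p k * (y - z) powi q k * f (x, y)))"
      by (subst contour_integral_sum) (auto intro: contour_integrable_lmul int simp: contour_integral_lmul int)
    finally show ?thesis .
  qed
  have "((\<lambda>x. \<Sum>k\<le>N. c k * contour_integral ?C (\<lambda>y. (x - z) powi p k * (y - z) powi q k * f (x, y)))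
      has_contour_integral (\<Sum>k\<le>N. c k * I k)) ?C"
    unfolding I_def
    by (intro has_contour_integral_sum has_contour_integral_lmul double_circlepath_moment assms) auto
  then have "((\<lambda>x. contour_integral ?C (\<lambda>y. kernel_term m1 m2 t l (x - z) (y - z) * f (x, y)))
      has_contour_integral (\<Sum>k\<le>N. c k * I k)) ?C"
    by (rule has_contour_integral_eq) (simp add: inner)
  then have "contour_integral ?C (\<lambda>x. contour_integral ?C (\<lambda>y. kernel_term m1 m2 t l (x - z) (y - z) * f (x, y)))
      = (\<Sum>k\<le>N. c k * I k)"
    by (rule contour_integral_unique)
  \<comment> \<open>Both exponents are negative only for \<open>k = m2 + j\<close> with \<open>j \<le> l\<close>, and then they are
      \<open>- (l - j) - 1\<close> and \<open>- j - 1\<close>.\<close>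
  also have "\<dots> = (\<Sum>k\<in>{m2..m2 + l}. c k * I k)"
    by (rule sum.mono_neutral_right) (auto simp: N_def I_def p_def q_def)
  also have "\<dots> = (\<Sum>j=0..l. c (m2 + j) * I (m2 + j))"
    by (rule sum.reindex_bij_witness[of _ "\<lambda>j. m2 + j" "\<lambda>k. k - m2"]) auto
  also have "\<dots> = (\<Sum>j=0..l. (2 * of_real pi * \<i>)\<^sup>2 *
      (fact (m1 + m2 + l) * t ^ l / (fact (m1 + l) * fact (m2 + l)) *
       ((- 1) ^ j * of_nat ((m1 + l) choose j) * of_nat ((m2 + l) choose (l - j)) * mixed_deriv (l - j) j f z z)))"
  proof (rule sum.cong[OF refl])
    fix j assume "j \<in> {0..l}"
    then have j: "j \<le> l" by simp
    have e: "nat (- p (m2 + j) - 1) = l - j" "nat (- q (m2 + j) - 1) = j" "p (m2 + j) < 0" "q (m2 + j) < 0"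
      using j by (auto simp: p_def q_def)
    have "c (m2 + j) * I (m2 + j) = (2 * of_real pi * \<i>)\<^sup>2 * (t ^ l * (- 1) ^ j * mixed_deriv (l - j) j f z z) *
        (of_nat (N choose (m2 + j)) / (fact (l - j) * fact j))"
      by (simp add: c_def I_def e power_add[symmetric] mult_2[symmetric] flip: add.assoc)
         (simp add: power_add)
    then show "c (m2 + j) * I (m2 + j) = (2 * of_real pi * \<i>)\<^sup>2 *
      (fact (m1 + m2 + l) * t ^ l / (fact (m1 + l) * fact (m2 + l)) *
       ((- 1) ^ j * of_nat ((m1 + l) choose j) * of_nat ((m2 + l) choose (l - j)) * mixed_deriv (l - j) j f z z))"
      unfolding N_def binomial_fact_Rankin_Cohen[OF j] by (simp add: mult_ac)
  qed
  also have "\<dots> = (2 * of_real pi * \<i>)\<^sup>2 * (fact (m1 + m2 + l) * t ^ l / (fact (m1 + l) * fact (m2 + l))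
           * RC (Suc m1) (Suc m2) l f z)"
    unfolding RC_def by (simp add: sum_distrib_left)
  finally show ?thesis .
qed

text \<open>The majorant is uniform in both variables, so the M-test applies to the inner integral and, after
  multiplying the majorant by the length of the circle, to the outer one.\<close>

lemma Rankin_Cohen_expansion_on_polydisc:
  assumes "0 < r" and t: "2 * norm t < r" and contf: "continuous_on (cball z r \<times> cball z r) f"
    and hol1: "\<And>y. y \<in> cball z r \<Longrightarrow> (\<lambda>x. f (x, y)) holomorphic_on ball z r"
    and hol2: "\<And>x. x \<in> cball z r \<Longrightarrow> (\<lambda>y. f (x, y)) holomorphic_on ball z r"
  shows "(\<lambda>l. fact (m1 + m2 + l) * t ^ l / (fact (m1 + l) * fact (m2 + l)) * RC (Suc m1) (Suc m2) l f z)
           sums T_op (Suc m1) (Suc m2) r f z t"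
proof -
  let ?C = "circlepath z r"
  define g where "g l x y = kernel_term m1 m2 t l (x - z) (y - z) * f (x, y)" for l x y
  have contg: "continuous_on (sphere z r \<times> sphere z r) (\<lambda>(x, y). g l x y)" for l
  proof -
    have "continuous_on (sphere z r \<times> sphere z r) f"
      using contf by (rule continuous_on_subset) auto
    from continuous_on_mult[OF continuous_on_kernel_term[OF \<open>0 < r\<close>] this] show ?thesis
      by (simp add: g_def case_prod_unfold)
  qed
  have intg: "g l x contour_integrable_on ?C" if "x \<in> sphere z r" for l x
    using continuous_on_slices(2)[OF contg] that \<open>0 < r\<close>
    by (intro contour_integrable_continuous_circlepath) simp
  have "bounded (f ` (cball z r \<times> cball z r))"
    using contf by (intro compact_imp_bounded compact_continuous_image compact_Times) auto
  then obtain M where "0 < M" and "\<forall>v \<in> f ` (cball z r \<times> cball z r). norm v \<le> M"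
    unfolding bounded_pos by metis
  then have M: "norm (f (x, y)) \<le> M" if "x \<in> cball z r" "y \<in> cball z r" for x y
    using that by blast
  define K where "K = (2 * r) ^ (m1 + m2) / r ^ (m1 + m2 + 2) * M"
  define b where "b l = K * (2 * norm t / r) ^ l" for l :: nat
  have "0 \<le> K" using \<open>0 < r\<close> \<open>0 < M\<close> by (simp add: K_def)
  then have "0 \<le> b l" for l using \<open>0 < r\<close> by (simp add: b_def)
  have "summable b"
    unfolding b_def using t \<open>0 < r\<close> by (intro summable_mult summable_geometric) simp
  have bound: "norm (g l x y) \<le> b l" if "x \<in> sphere z r" "y \<in> sphere z r" for l x y
  proof -
    have "norm (g l x y) \<le> (2 * r) ^ (m1 + m2) / r ^ (m1 + m2 + 2) * (2 * norm t / r) ^ l * M"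
      unfolding g_def norm_mult using that \<open>0 < r\<close>
      by (intro mult_mono norm_kernel_term_le M) (auto simp: dist_norm norm_minus_commute)
    then show ?thesis by (simp add: b_def K_def mult_ac)
  qed
  have sums_g: "(\<lambda>l. g l x y) sums (A_kernel (Suc m1) (Suc m2) x y z t * f (x, y))"
    if "x \<in> sphere z r" "y \<in> sphere z r" for x y
    unfolding g_def
  proof (intro sums_mult2 A_kernel_sums)
    have xr: "norm (x - z) = r" "norm (y - z) = r"
      using that by (auto simp: dist_norm norm_minus_commute)
    have "norm (x - y) \<le> 2 * r"
      using norm_triangle_ineq4[of "x - z" "y - z"] xr by simp
    then have "norm (t * (x - y)) \<le> norm t * (2 * r)"
      by (simp add: norm_mult mult_left_mono)
    also have "\<dots> < r * r" using mult_strict_right_mono[OF t \<open>0 < r\<close>] by simp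
    finally show "norm (t * (x - y)) < norm ((x - z) * (y - z))" by (simp add: norm_mult xr)
  qed
  have inner: "(\<lambda>l. contour_integral ?C (g l x)) sums
      contour_integral ?C (\<lambda>y. A_kernel (Suc m1) (Suc m2) x y z t * f (x, y))"
    if "x \<in> sphere z r" for x
    using \<open>0 < r\<close> \<open>summable b\<close> intg[OF that] bound[OF that] sums_g[OF that]
    by (rule circlepath_integral_sums)
  have "(\<lambda>l. contour_integral ?C (\<lambda>x. contour_integral ?C (g l x))) sums
      contour_integral ?C (\<lambda>x. contour_integral ?C (\<lambda>y. A_kernel (Suc m1) (Suc m2) x y z t * f (x, y)))"
  proof (rule circlepath_integral_sums[OF \<open>0 < r\<close> _ _ _ inner])
    show "summable (\<lambda>l. b l * (2 * pi * r))"
      using \<open>summable b\<close> by (rule summable_mult2)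
    show "(\<lambda>x. contour_integral ?C (g l x)) contour_integrable_on ?C" for l
      using continuous_on_circlepath_integral_param[OF _ contg] \<open>0 < r\<close>
      by (intro contour_integrable_continuous_circlepath) auto
    show "norm (contour_integral ?C (g l x)) \<le> b l * (2 * pi * r)" if "x \<in> sphere z r" for l x
      using has_contour_integral_integral[OF intg[OF that]] \<open>0 \<le> b l\<close> \<open>0 < r\<close>
      by (rule has_contour_integral_bound_circlepath)
         (auto intro!: bound that simp: dist_norm norm_minus_commute)
  qed
  moreover have "contour_integral ?C (\<lambda>x. contour_integral ?C (g l x))
      = (2 * of_real pi * \<i>)\<^sup>2 * (fact (m1 + m2 + l) * t ^ l / (fact (m1 + l) * fact (m2 + l))
           * RC (Suc m1) (Suc m2) l f z)" for l
    unfolding g_def using assms by (intro double_integral_kernel_term)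
  ultimately have "(\<lambda>l. 1 / (2 * of_real pi * \<i>)\<^sup>2 * ((2 * of_real pi * \<i>)\<^sup>2 *
      (fact (m1 + m2 + l) * t ^ l / (fact (m1 + l) * fact (m2 + l)) * RC (Suc m1) (Suc m2) l f z)))
      sums T_op (Suc m1) (Suc m2) r f z t"
    unfolding T_op_def by (intro sums_mult) simp
  then show ?thesis
    by simp
qed

section \<open>Functions holomorphic on a product domain\<close>

lemma holomorphic2_on_imp_continuous_on:
  "f holomorphic2_on S \<Longrightarrow> continuous_on S f"
  unfolding holomorphic2_on_def continuous_on_eq_continuous_within
  by (meson has_derivative_continuous)

lemma holomorphic2_on_slices:
  assumes f: "f holomorphic2_on A \<times> B"
  shows "y \<in> B \<Longrightarrow> (\<lambda>x. f (x, y)) holomorphic_on A"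
    and "x \<in> A \<Longrightarrow> (\<lambda>y. f (x, y)) holomorphic_on B"
proof -
  show "(\<lambda>x. f (x, y)) holomorphic_on A" if "y \<in> B"
  proof (rule holomorphic_onI)
    fix x assume "x \<in> A"
    then have "(x, y) \<in> A \<times> B" using that by simp
    then obtain a b where "(f has_derivative (\<lambda>(h, k). a * h + b * k)) (at (x, y) within A \<times> B)"
      using f unfolding holomorphic2_on_def by metis
    then have "(f has_derivative (\<lambda>(h, k). a * h + b * k)) (at (x, y) within (\<lambda>x. (x, y)) ` A)"
      by (rule has_derivative_subset) (use that in auto)
    moreover have "((\<lambda>x. (x, y)) has_derivative (\<lambda>h. (h, 0))) (at x within A)"
      by (auto intro!: derivative_eq_intros)
    ultimately have "((\<lambda>x. f (x, y)) has_derivative (\<lambda>h. a * h)) (at x within A)"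
      using has_derivative_in_compose by fastforce
    then show "(\<lambda>x. f (x, y)) field_differentiable at x within A"
      by (auto simp: field_differentiable_def has_field_derivative_def)
  qed
  show "(\<lambda>y. f (x, y)) holomorphic_on B" if "x \<in> A"
  proof (rule holomorphic_onI)
    fix y assume "y \<in> B"
    then have "(x, y) \<in> A \<times> B" using that by simp
    then obtain a b where "(f has_derivative (\<lambda>(h, k). a * h + b * k)) (at (x, y) within A \<times> B)"
      using f unfolding holomorphic2_on_def by metis
    then have "(f has_derivative (\<lambda>(h, k). a * h + b * k)) (at (x, y) within (\<lambda>y. (x, y)) ` B)"
      by (rule has_derivative_subset) (use that in auto)
    moreover have "((\<lambda>y. (x, y)) has_derivative (\<lambda>k. (0, k))) (at y within B)"
      by (auto intro!: derivative_eq_intros)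
    ultimately have "((\<lambda>y. f (x, y)) has_derivative (\<lambda>k. b * k)) (at y within B)"
      using has_derivative_in_compose by fastforce
    then show "(\<lambda>y. f (x, y)) field_differentiable at y within B"
      by (auto simp: field_differentiable_def has_field_derivative_def)
  qed
qed

text \<open>A disc around a point of \<open>D\<close> that leaves \<open>D\<close> is connected, hence meets the frontier.\<close>

lemma cball_subset_if_less_bdist:
  assumes "z \<in> D" and "ereal r < bdist D z"
  shows "cball z r \<subseteq> D"
proof (cases "D = UNIV \<or> r < 0")
  case False
  then have r: "r < infdist z (frontier D)"
    using assms by (simp add: bdist_def)
  show ?thesis
  proof (rule ccontr)
    assume "\<not> cball z r \<subseteq> D"
    then have "cball z r - D \<noteq> {}" by blast
    moreover have "z \<in> cball z r \<inter> D" using assms(1) False by simp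
    then have "cball z r \<inter> D \<noteq> {}" by blast
    ultimately have "cball z r \<inter> frontier D \<noteq> {}"
      by (intro connected_Int_frontier convex_connected convex_cball)
    then obtain w where "dist z w \<le> r" "w \<in> frontier D" by auto
    then show False
      using infdist_le[of w "frontier D" z] r by linarith
  qed
qed auto

theorem theorem2:
  fixes D :: "complex set" and l1 l2 :: nat
    and f :: "complex \<times> complex \<Rightarrow> complex" and z t :: complex and r :: real
  assumes "open D" and "connected D" and "D \<noteq> {}"
    and "l1 \<ge> 1" and "l2 \<ge> 1"
    and "f holomorphic2_on (D \<times> D)"
    and "(z, t) \<in> U_dom D"
    and "admissible_radius D z t r"
  shows "(\<lambda>l. fact (l1 + l2 + l - 2) * t ^ l / (fact (l1 + l - 1) * fact (l2 + l - 1)) * RC l1 l2 l f z)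
           sums T_op l1 l2 r f z t"
proof -
  have r: "0 < r" "2 * norm t < r" "ereal r < bdist D z" and "z \<in> D"
    using assms by (auto simp: admissible_radius_def U_dom_def)
  then have sub: "cball z r \<subseteq> D"
    by (intro cball_subset_if_less_bdist)
  then have subb: "ball z r \<subseteq> D"
    using ball_subset_cball by blast
  obtain m1 m2 where m: "l1 = Suc m1" "l2 = Suc m2"
    using assms(4,5) by (metis Suc_le_D One_nat_def)
  have "continuous_on (cball z r \<times> cball z r) f"
    using holomorphic2_on_imp_continuous_on[OF assms(6)] by (rule continuous_on_subset) (use sub in auto)
  moreover have "(\<lambda>x. f (x, y)) holomorphic_on ball z r" "(\<lambda>x. f (y, x)) holomorphic_on ball z r"
    if "y \<in> cball z r" for y
    using holomorphic2_on_slices[OF assms(6), of y] that sub subb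
    by (blast intro: holomorphic_on_subset)+
  ultimately show ?thesis
    using Rankin_Cohen_expansion_on_polydisc[OF r(1,2), of z f m1 m2] unfolding m by simp
qed

end
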